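(* Let $k\geq1$, let $(X,d)$ be a compact metric space, let $T:\mathbb{Z}^k\times X\to X$ be an expansive continuous action and let $R:\mathbb{Z}^{k-1}\times X\to X$ be a continuous action commuting with $T$. If the topological entropy of $T$ is zero, then $\mathrm{mdim}(X,R)=0$.
   Context: Expansive: there is $c>0$ with $\sup_{u\in\mathbb{Z}^k}d(T^ux,T^uy)>c$ for distinct $x,y$. For a continuous action $S$ of $\mathbb{Z}^m$ and $\Omega\subset\mathbb{R}^m$, $d^S_\Omega(x,y)=\sup_{u\in\Omega\cap\mathbb{Z}^m}d(S^ux,S^uy)$. Topological entropy: $h_{\mathrm{top}}(T)=\lim_{\varepsilon\to0}\lim_{N\to\infty}\log\#(X,d^T_{[-N,N]^k},\varepsilon)/(2N+1)^k$, where $\#(X,\rho,\varepsilon)$ is the minimal cardinality of an open cover of $X$ whose members have $\rho$-diameter $<\varepsilon$. Mean dimension: $\mathrm{ord}(\mathcal{U})$ is the largest $n$ such that $n+1$ distinct members of the open cover $\mathcal{U}$ intersect; $\mathrm{widim}_\varepsilon(X,\rho)$ is the minimal order of an open cover with all $\rho$-diameters $\leq\varepsilon$; $\mathrm{mdim}(X,S)=\lim_{\varepsilon\to0}\lim_{N\to\infty}\mathrm{widim}_\varepsilon(X,d^S_{[-N,N]^m})/(2N+1)^m$ (for $m=0$ it is $\dim X$). *)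

theory Defs
  imports "HOL-Analysis.Analysis"
begin

definition lattice :: "nat \<Rightarrow> (nat \<Rightarrow> int) set" where
  "lattice m = {u. \<forall>i\<ge>m. u i = 0}"

definition box :: "nat \<Rightarrow> nat \<Rightarrow> (nat \<Rightarrow> int) set" where
  "box m N = {u \<in> lattice m. \<forall>i<m. \<bar>u i\<bar> \<le> int N}"

definition cont_action :: "nat \<Rightarrow> 'a::topological_space set \<Rightarrow> ((nat \<Rightarrow> int) \<Rightarrow> 'a \<Rightarrow> 'a) \<Rightarrow> bool" where
  "cont_action m X S \<longleftrightarrow>
     (\<forall>u\<in>lattice m. S u ` X \<subseteq> X \<and> continuous_on X (S u)) \<and>
     (\<forall>x\<in>X. S (\<lambda>i. 0) x = x) \<and>
     (\<forall>u\<in>lattice m. \<forall>v\<in>lattice m. \<forall>x\<in>X. S (\<lambda>i. u i + v i) x = S u (S v x))"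

definition expansive :: "nat \<Rightarrow> 'a::metric_space set \<Rightarrow> ((nat \<Rightarrow> int) \<Rightarrow> 'a \<Rightarrow> 'a) \<Rightarrow> bool" where
  "expansive m X S \<longleftrightarrow> (\<exists>c>0. \<forall>x\<in>X. \<forall>y\<in>X. x \<noteq> y \<longrightarrow>
      (SUP u\<in>lattice m. dist (S u x) (S u y)) > c)"

definition dbox :: "((nat \<Rightarrow> int) \<Rightarrow> 'a \<Rightarrow> 'a) \<Rightarrow> nat \<Rightarrow> nat \<Rightarrow> 'a::metric_space \<Rightarrow> 'a \<Rightarrow> real" where
  "dbox S m N x y = (SUP u\<in>box m N. dist (S u x) (S u y))"

text \<open>Diameter of a set w.r.t. a (pseudo)metric rho (0 for the empty set).\<close>
definition rdiam :: "('a \<Rightarrow> 'a \<Rightarrow> real) \<Rightarrow> 'a set \<Rightarrow> real" where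
  "rdiam \<rho> U = Sup ({\<rho> x y | x y. x \<in> U \<and> y \<in> U} \<union> {0})"

definition open_cover :: "'a::topological_space set \<Rightarrow> 'a set set \<Rightarrow> bool" where
  "open_cover X \<U> \<longleftrightarrow> finite \<U> \<and> (\<forall>U\<in>\<U>. openin (top_of_set X) U) \<and> X \<subseteq> \<Union>\<U>"

definition covnum :: "'a::topological_space set \<Rightarrow> ('a \<Rightarrow> 'a \<Rightarrow> real) \<Rightarrow> real \<Rightarrow> nat" where
  "covnum X \<rho> \<epsilon> = Inf {card \<U> | \<U>. open_cover X \<U> \<and> (\<forall>U\<in>\<U>. rdiam \<rho> U < \<epsilon>)}"

definition entropy_seq :: "nat \<Rightarrow> 'a::metric_space set \<Rightarrow> ((nat \<Rightarrow> int) \<Rightarrow> 'a \<Rightarrow> 'a) \<Rightarrow> real \<Rightarrow> nat \<Rightarrow> real" where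
  "entropy_seq k X T \<epsilon> N = ln (real (covnum X (dbox T k N) \<epsilon>)) / real ((2*N+1)^k)"

definition zero_entropy :: "nat \<Rightarrow> 'a::metric_space set \<Rightarrow> ((nat \<Rightarrow> int) \<Rightarrow> 'a \<Rightarrow> 'a) \<Rightarrow> bool" where
  "zero_entropy k X T \<longleftrightarrow> (\<forall>\<epsilon>>0. convergent (entropy_seq k X T \<epsilon>)) \<and>
      ((\<lambda>\<epsilon>. lim (entropy_seq k X T \<epsilon>)) \<longlongrightarrow> 0) (at_right 0)"

definition cover_ord :: "'a set set \<Rightarrow> nat" where
  "cover_ord \<U> = Max {card V - 1 | V. V \<subseteq> \<U> \<and> V \<noteq> {} \<and> finite V \<and> \<Inter>V \<noteq> {}}"

definition widim :: "'a::topological_space set \<Rightarrow> ('a \<Rightarrow> 'a \<Rightarrow> real) \<Rightarrow> real \<Rightarrow> nat" where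
  "widim X \<rho> \<epsilon> = Inf {cover_ord \<U> | \<U>. open_cover X \<U> \<and> (\<forall>U\<in>\<U>. rdiam \<rho> U \<le> \<epsilon>)}"

definition mdim_seq :: "nat \<Rightarrow> 'a::metric_space set \<Rightarrow> ((nat \<Rightarrow> int) \<Rightarrow> 'a \<Rightarrow> 'a) \<Rightarrow> real \<Rightarrow> nat \<Rightarrow> real" where
  "mdim_seq m X S \<epsilon> N = real (widim X (dbox S m N) \<epsilon>) / real ((2*N+1)^m)"

definition zero_mdim :: "nat \<Rightarrow> 'a::metric_space set \<Rightarrow> ((nat \<Rightarrow> int) \<Rightarrow> 'a \<Rightarrow> 'a) \<Rightarrow> bool" where
  "zero_mdim m X S \<longleftrightarrow> (\<forall>\<epsilon>>0. convergent (mdim_seq m X S \<epsilon>)) \<and>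
      ((\<lambda>\<epsilon>. lim (mdim_seq m X S \<epsilon>)) \<longlongrightarrow> 0) (at_right 0)"

end

theory Submission
  imports Defs
begin

text \<open>
  Put \<open>E n\<close> for the pairs that stay \<open>c\<close>-close under \<open>T\<close> on the box of radius \<open>n\<close>, with \<open>c\<close> an
  expansivity constant. By compactness \<open>E (n + L) O E (n + L) \<subseteq> E n\<close> for a fixed \<open>L\<close>, so that
  \<open>2 ^ N\<close> successive steps in \<open>E (n0 + L N)\<close> stay inside \<open>E n0\<close>; and since \<open>R\<close> commutes
  with \<open>T\<close>, there is a fixed \<open>M\<close> such that \<open>R u\<close> maps \<open>E (n + M N)\<close> into \<open>E n\<close> for all \<open>u\<close> in
  the box of radius \<open>N\<close>. Hence a \<open>T\<close>-cover of \<open>X\<close> at radius \<open>O(N)\<close>, which by zero entropy has only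
  \<open>exp (o (N ^ k))\<close> members, is exponentially finer in \<open>N\<close> than any fixed scale, uniformly along
  the \<open>R\<close>-orbit.

  Fix a finite net. For every net point there are about \<open>2 ^ N\<close> Urysohn functions \<open>F s\<close> that
  pass from 0 on a small ball around it to 1 off the concentric ball of twice the radius, with
  transition regions \<open>E (n0 + L N)\<close>-separated from each other. Take as coordinates the pairs of an
  element of the \<open>R\<close>-box and a net point; there are \<open>O (N ^ (k - 1))\<close> of them. A counting argument
  chooses one \<open>s\<close> for each coordinate such that no point lies in the transition region of more
  than \<open>D = o (N ^ (k - 1))\<close> coordinates: a random choice puts a given member of the \<open>T\<close>-cover
  into a given transition region with probability at most \<open>2 ^ - N\<close>. Grouping the points by the set
  of coordinates in transition gives an open cover of order at most \<open>D\<close>.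
\<close>

section \<open>Boxes in the integer lattice\<close>

lemma box_subset_lattice: "box m N \<subseteq> lattice m"
  by (auto simp: box_def)

lemma box_mono: "M \<le> N \<Longrightarrow> box m M \<subseteq> box m N"
  unfolding box_def by (auto intro: order_trans)

lemma zero_in_box: "(\<lambda>i. 0) \<in> box m N"
  by (auto simp: box_def lattice_def)

lemma box_add: "u \<in> box m M \<Longrightarrow> v \<in> box m N \<Longrightarrow> (\<lambda>i. u i + v i) \<in> box m (M + N)"
  unfolding box_def lattice_def by (auto intro: order_trans[OF abs_triangle_ineq add_mono])

text \<open>Clamping every coordinate to [-N, N] leaves a remainder of absolute value at most 1.
  Induction on \<open>N\<close> thus breaks a move in \<open>box m N\<close> into moves in
  \<open>box m 1\<close>.\<close>

lemma box_split_Suc: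
  assumes "u \<in> box m (Suc N)"
  obtains v w where "v \<in> box m 1" "w \<in> box m N" "u = (\<lambda>i. v i + w i)"
proof
  let ?w = "\<lambda>i. max (- int N) (min (int N) (u i))"
  show "?w \<in> box m N"
    using assms by (auto simp: box_def lattice_def)
  have "\<bar>u i - ?w i\<bar> \<le> 1" if "i < m" for i
  proof -
    have "\<bar>u i\<bar> \<le> int N + 1" using assms that by (force simp: box_def)
    then show ?thesis by linarith
  qed
  then show "(\<lambda>i. u i - ?w i) \<in> box m 1"
    using assms by (auto simp: box_def lattice_def)
  show "u = (\<lambda>i. (u i - ?w i) + ?w i)" by simp
qed

lemma
  shows finite_box: "finite (box m N)"
    and card_box_le: "card (box m N) \<le> (2 * N + 1) ^ m"
proof -
  let ?P = "PiE {..<m} (\<lambda>_. {- int N..int N})"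
  have inj: "inj_on (\<lambda>u. restrict u {..<m}) (box m N)"
  proof (rule inj_onI, rule ext)
    fix u v i
    assume *: "u \<in> box m N" "v \<in> box m N" "restrict u {..<m} = restrict v {..<m}"
    show "u i = v i"
    proof (cases "i < m")
      case True
      then show ?thesis using fun_cong[OF *(3), of i] by simp
    next
      case False
      then show ?thesis using *(1,2) by (simp add: box_def lattice_def)
    qed
  qed
  have sub: "(\<lambda>u. restrict u {..<m}) ` box m N \<subseteq> ?P"
  proof (intro image_subsetI, unfold restrict_PiE_iff)
    show "\<forall>i\<in>{..<m}. u i \<in> {- int N..int N}" if "u \<in> box m N" for u
      using that by (auto simp: box_def abs_le_iff minus_le_iff)
  qed
  have fin: "finite ?P" by (intro finite_PiE) auto
  have "card ?P = (2 * N + 1) ^ m"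
  proof -
    have "card {- int N..int N} = 2 * N + 1" by simp
    then show ?thesis by (simp only: card_PiE finite_lessThan prod_constant card_lessThan)
  qed
  then have "card (box m N) \<le> (2 * N + 1) ^ m"
    using card_inj_on_le[OF inj sub fin] by (simp only:)
  with inj_on_finite[OF inj sub fin] show "finite (box m N)" "card (box m N) \<le> (2 * N + 1) ^ m" .
qed

section \<open>Box metrics, diameters and covering numbers\<close>

lemma dist_le_dbox:
  assumes "u \<in> box m N"
  shows "dist (S u x) (S u y) \<le> dbox S m N x y"
  unfolding dbox_def using assms finite_box by (intro cSUP_upper) auto

lemma dbox_le:
  assumes "\<And>u. u \<in> box m N \<Longrightarrow> dist (S u x) (S u y) \<le> e"
  shows "dbox S m N x y \<le> e"
  unfolding dbox_def using assms zero_in_box by (intro cSUP_least) auto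

lemma rdiam_le:
  assumes "\<And>x y. x \<in> U \<Longrightarrow> y \<in> U \<Longrightarrow> \<rho> x y \<le> e" "0 \<le> e"
  shows "rdiam \<rho> U \<le> e"
  unfolding rdiam_def using assms by (intro cSup_least) auto

lemma compact_cont_action_equicontinuous:
  fixes X :: "'a::metric_space set"
  assumes "compact X" "cont_action m X S" "0 < e"
  obtains d where "0 < d"
    "\<And>x y u. x \<in> X \<Longrightarrow> y \<in> X \<Longrightarrow> dist x y < d \<Longrightarrow> u \<in> box m N \<Longrightarrow> dist (S u x) (S u y) < e"
proof -
  have "\<exists>d>0. \<forall>x\<in>X. \<forall>y\<in>X. dist x y < d \<longrightarrow> dist (S u x) (S u y) < e" if "u \<in> box m N" for u
  proof -
    have "continuous_on X (S u)"
      using assms(2) that by (auto simp: cont_action_def box_def)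
    then have "uniformly_continuous_on X (S u)"
      using assms(1) compact_uniformly_continuous by blast
    then show ?thesis
      using assms(3) unfolding uniformly_continuous_on_def by (metis dist_commute)
  qed
  then obtain d where d: "\<And>u. u \<in> box m N \<Longrightarrow> 0 < d u"
    "\<And>u x y. u \<in> box m N \<Longrightarrow> x \<in> X \<Longrightarrow> y \<in> X \<Longrightarrow> dist x y < d u \<Longrightarrow> dist (S u x) (S u y) < e"
    by metis
  show thesis
  proof
    show "0 < Min (d ` box m N)"
      using d(1) finite_box[of m N] zero_in_box[of m N] by (subst Min_gr_iff) auto
    show "dist (S u x) (S u y) < e"
      if "x \<in> X" "y \<in> X" "dist x y < Min (d ` box m N)" "u \<in> box m N" for x y u
    proof (rule d(2))
      have "Min (d ` box m N) \<le> d u"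
        using that finite_box[of m N] by (intro Min_le) auto
      then show "dist x y < d u" using that by linarith
    qed (use that in auto)
  qed
qed

text \<open>\<open>rdiam\<close> is a real supremum, which controls its elements only when they are
  bounded above; compactness of \<open>X\<close> supplies the bound.\<close>

lemma dbox_eq_diam_bounds_dist:
  fixes X :: "'a::metric_space set"
  assumes "compact X" "cont_action m X S" "U \<subseteq> X" "rdiam (dbox S m N) U < e"
    "x \<in> U" "y \<in> U" "u \<in> box m N"
  shows "dist (S u x) (S u y) < e"
proof -
  have inv: "S v z \<in> X" if "v \<in> box m N" "z \<in> X" for v z
    using assms(2) that by (auto simp: cont_action_def box_def)
  obtain B where B: "\<And>z w. z \<in> X \<Longrightarrow> w \<in> X \<Longrightarrow> dist z w \<le> B"
    using compact_imp_bounded[OF assms(1)] unfolding bounded_two_points by blast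
  have "bdd_above ({dbox S m N x y | x y. x \<in> U \<and> y \<in> U} \<union> {0})"
  proof (rule bdd_aboveI[of _ "max B 0"])
    fix r assume "r \<in> {dbox S m N x y | x y. x \<in> U \<and> y \<in> U} \<union> {0}"
    then consider "r = 0" | z w where "z \<in> U" "w \<in> U" "r = dbox S m N z w" by auto
    then show "r \<le> max B 0"
    proof cases
      case 2
      have "dbox S m N z w \<le> B"
        using 2 assms(3) by (intro dbox_le B inv) auto
      then show ?thesis using 2 by simp
    qed simp
  qed
  then have "dbox S m N x y \<le> rdiam (dbox S m N) U"
    unfolding rdiam_def using assms(5,6) by (intro cSup_upper) auto
  then show ?thesis using dist_le_dbox[OF assms(7), of S x y] assms(4) by linarith
qed

text \<open>The natural number \<open>covnum\<close> is an infimum, attained as soon as its set is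
  nonempty; this provides the element.\<close>

lemma open_cover_small_rdiam_exists:
  fixes X :: "'a::metric_space set"
  assumes "compact X" "cont_action m X S" "0 < e"
  shows "\<exists>\<U>. open_cover X \<U> \<and> (\<forall>U\<in>\<U>. rdiam (dbox S m N) U < e)"
proof -
  \<comment> \<open>A supremum inherits only a non-strict bound, hence the margin
    \<open>e / 2\<close>.\<close>
  obtain d where d: "0 < d"
    "\<And>x y u. x \<in> X \<Longrightarrow> y \<in> X \<Longrightarrow> dist x y < d \<Longrightarrow> u \<in> box m N \<Longrightarrow> dist (S u x) (S u y) < e / 2"
    using compact_cont_action_equicontinuous[OF assms(1,2), of "e / 2" N] assms(3) by auto
  obtain F where F: "finite F" "X \<subseteq> (\<Union>p\<in>F. ball p (d / 2))"
    using assms(1) d(1) unfolding compact_eq_totally_bounded by (metis half_gt_zero)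
  have "open_cover X ((\<lambda>p. X \<inter> ball p (d / 2)) ` F)"
    using F unfolding open_cover_def by (fastforce simp: openin_open_Int)
  moreover have "rdiam (dbox S m N) (X \<inter> ball p (d / 2)) < e" for p
  proof -
    have "rdiam (dbox S m N) (X \<inter> ball p (d / 2)) \<le> e / 2"
    proof (intro rdiam_le dbox_le less_imp_le[OF d(2)])
      fix x y assume "x \<in> X \<inter> ball p (d / 2)" "y \<in> X \<inter> ball p (d / 2)"
      then show "dist x y < d"
        using dist_triangle_half_r[of p x d y] by (simp add: dist_commute)
    qed (use assms(3) in auto)
    then show ?thesis using assms(3) by simp
  qed
  ultimately show ?thesis by blast
qed

lemma covnum_attained:
  fixes X :: "'a::metric_space set"
  assumes "compact X" "cont_action m X S" "0 < e"
  obtains \<U> where "open_cover X \<U>" "\<And>U. U \<in> \<U> \<Longrightarrow> rdiam (dbox S m N) U < e"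
    "card \<U> = covnum X (dbox S m N) e"
proof -
  have "covnum X (dbox S m N) e
      \<in> {card \<U> | \<U>. open_cover X \<U> \<and> (\<forall>U\<in>\<U>. rdiam (dbox S m N) U < e)}"
    unfolding covnum_def
    by (rule Inf_nat_def1) (use open_cover_small_rdiam_exists[OF assms, of N] in auto)
  then show thesis using that by auto
qed

lemma widim_le:
  assumes "open_cover X \<U>" "\<And>U. U \<in> \<U> \<Longrightarrow> rdiam \<rho> U \<le> e" "cover_ord \<U> \<le> D"
  shows "widim X \<rho> e \<le> D"
proof -
  have "widim X \<rho> e \<le> cover_ord \<U>"
    unfolding widim_def by (rule cInf_lower) (use assms in auto)
  then show ?thesis using assms(3) by simp
qed

section \<open>Covers whose order is bounded by the number of transitional coordinates\<close>

text \<open>With values clamped to [0, 1], the coordinates \<open>g i\<close> map \<open>X\<close>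
  into the \<open>D\<close>-skeleton of the cube over \<open>I\<close>. The cover is pulled back
  from one indexed by the faces of dimension at most \<open>D\<close>: \<open>S\<close> holds the
  free coordinates of a face and \<open>P\<close> those fixed at 1.\<close>

lemma transition_cover:
  fixes X :: "'a::topological_space set" and g :: "'i \<Rightarrow> 'a \<Rightarrow> real"
  assumes "X \<noteq> {}" "finite I"
    and cont: "\<And>i. i \<in> I \<Longrightarrow> continuous_on X (g i)"
    and few: "\<And>x. x \<in> X \<Longrightarrow> card {i \<in> I. 0 < g i x \<and> g i x < 1} \<le> D"
  obtains \<U> where "open_cover X \<U>" "cover_ord \<U> \<le> D"
    "\<And>U x y i. U \<in> \<U> \<Longrightarrow> x \<in> U \<Longrightarrow> y \<in> U \<Longrightarrow> i \<in> I \<Longrightarrow> g i x = 0 \<Longrightarrow> g i y < 1"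
proof -
  \<comment> \<open>The level \<open>j\<close> sets of the cover have exactly \<open>j\<close> coordinates within \<open>r j\<close> of the
    middle value and the others farther than \<open>r j\<close>, so that sets of one level are disjoint; since
    \<open>r\<close> increases, a point missed by all levels up to \<open>D\<close> has more than \<open>D\<close> transitional
    coordinates.\<close>
  define r where "r j = (real j + 1) / (2 * (real D + 2))" for j
  have r_mono: "r j < r j'" if "j < j'" for j j'
    using that unfolding r_def by (intro divide_strict_right_mono) auto
  have r_pos: "0 < r j" for j
    unfolding r_def by simp
  have r_half: "r j < 1 / 2" if "j \<le> D" for j
    using that unfolding r_def by (simp add: field_simps)
  define C where "C = (\<lambda>(S, P). {x \<in> X. (\<forall>i\<in>S. \<bar>g i x - 1 / 2\<bar> < r (card S))
      \<and> (\<forall>i\<in>P. g i x > 1 / 2 + r (card S)) \<and> (\<forall>i\<in>I - S - P. g i x < 1 / 2 - r (card S))})"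
  define J where "J = {(S, P). S \<subseteq> I \<and> P \<subseteq> I - S \<and> card S \<le> D}"
  let ?near = "\<lambda>x j. {i \<in> I. \<bar>g i x - 1 / 2\<bar> < r j}"
  let ?near_eq = "\<lambda>x j. {i \<in> I. \<bar>g i x - 1 / 2\<bar> \<le> r j}"
  let ?above = "\<lambda>x j. {i \<in> I. g i x > 1 / 2 + r j}"
  have "finite J"
    by (rule finite_subset[of _ "Pow I \<times> Pow I"]) (use assms(2) in \<open>auto simp: J_def\<close>)
  have opn: "openin (top_of_set X) (C (S, P))" if "(S, P) \<in> J" for S P
  proof -
    have fin: "finite S" "finite P" "finite (I - S - P)" and sub: "S \<subseteq> I" "P \<subseteq> I"
      using that assms(2) finite_subset by (auto simp: J_def intro: finite_subset)
    have "openin (top_of_set X) (X \<inter> (\<Inter>i\<in>A. X \<inter> g i -` B))"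
      if "finite A" "A \<subseteq> I" "open B" for A B
    proof -
      have "openin (top_of_set X) (X \<inter> g i -` B)" if "i \<in> A" for i
        using cont that \<open>A \<subseteq> I\<close> \<open>open B\<close> continuous_openin_preimage_gen by blast
      then have "openin (top_of_set X) ((\<Inter>i\<in>A. X \<inter> g i -` B) \<inter> topspace (top_of_set X))"
        using that(1) by (intro openin_INT)
      then show ?thesis by (simp add: Int_commute)
    qed
    note * = this
    have eq: "C (S, P) = (X \<inter> (\<Inter>i\<in>S. X \<inter> g i -` {1/2 - r (card S)<..<1/2 + r (card S)}))
      \<inter> (X \<inter> (\<Inter>i\<in>P. X \<inter> g i -` {1/2 + r (card S)<..}))
      \<inter> (X \<inter> (\<Inter>i\<in>I - S - P. X \<inter> g i -` {..<1/2 - r (card S)}))"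
      unfolding C_def by (auto simp: abs_less_iff algebra_simps)
    show ?thesis
      unfolding eq by (rule openin_Int[OF openin_Int[OF * *] *]) (use fin sub in auto)
  qed
  have char: "S = ?near x (card S) \<and> P = ?above x (card S)" if "(S, P) \<in> J" "x \<in> C (S, P)" for S P x
  proof -
    have *: "S \<subseteq> I" "P \<subseteq> I" using that(1) by (auto simp: J_def)
    have "g i x < 1 / 2 - r (card S)" if "i \<in> I" "i \<notin> S" "i \<notin> P" for i
      using \<open>x \<in> C (S, P)\<close> that by (simp add: C_def)
    moreover have "\<bar>g i x - 1 / 2\<bar> < r (card S)" if "i \<in> S" for i
      using \<open>x \<in> C (S, P)\<close> that by (simp add: C_def)
    moreover have "g i x > 1 / 2 + r (card S)" if "i \<in> P" for i
      using \<open>x \<in> C (S, P)\<close> that by (simp add: C_def)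
    ultimately have "i \<in> S \<longleftrightarrow> \<bar>g i x - 1 / 2\<bar> < r (card S)" "i \<in> P \<longleftrightarrow> g i x > 1 / 2 + r (card S)"
      if "i \<in> I" for i
      using that r_pos[of "card S"] by (smt (verit))+
    then show ?thesis using * by blast
  qed
  have cov: "X \<subseteq> \<Union>(C ` J)"
  proof
    fix x assume x: "x \<in> X"
    let ?Q = "\<lambda>j. card (?near_eq x j) \<le> j"
    have "card (?near_eq x D) \<le> card {i \<in> I. 0 < g i x \<and> g i x < 1}"
      using r_half[of D] assms(2) by (intro card_mono) (auto simp: abs_le_iff)
    then have QD: "?Q D" using few[OF x] by simp
    \<comment> \<open>For positive \<open>j\<close>, minimality gives at least \<open>j\<close>
      coordinates within the previous radius, hence strictly within \<open>r j\<close>, while at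
      most \<open>j\<close> are within \<open>r j\<close> non-strictly. So no coordinate sits at
      distance exactly \<open>r j\<close>.\<close>
    define j where "j = (LEAST j. ?Q j)"
    have Qj: "?Q j" unfolding j_def by (rule LeastI[of ?Q, OF QD])
    have jD: "j \<le> D" unfolding j_def by (rule Least_le[of ?Q, OF QD])
    have fin: "finite (?near_eq x j)" using assms(2) by simp
    have sub: "?near x j \<subseteq> ?near_eq x j" by auto
    have "j \<le> card (?near x j)"
    proof (cases j)
      case (Suc l)
      then have "\<not> ?Q l" using not_less_Least[of l ?Q] by (simp add: j_def)
      then have "j \<le> card (?near_eq x l)" using Suc by simp
      also have "\<dots> \<le> card (?near x j)"
        using r_mono[of l j] Suc assms(2) by (intro card_mono) auto
      finally show ?thesis .
    qed simp
    with Qj card_mono[OF fin sub] have crd: "card (?near x j) = j" "card (?near_eq x j) = j"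
      by linarith+
    then have eq: "?near x j = ?near_eq x j" using card_subset_eq[OF fin sub] by simp
    have below: "g i x < 1 / 2 - r j" if "i \<in> I - ?near x j - ?above x j" for i
    proof -
      have "i \<notin> ?near_eq x j" using that eq by blast
      then have "\<bar>g i x - 1 / 2\<bar> > r j" "\<not> g i x > 1 / 2 + r j" using that by auto
      then show ?thesis by linarith
    qed
    have "x \<in> C (?near x j, ?above x j)"
      unfolding C_def using x below by (simp only: prod.case crd(1)) blast
    moreover have "(?near x j, ?above x j) \<in> J"
    proof -
      have "?above x j \<subseteq> I - ?near x j" by auto
      moreover have "card (?near x j) \<le> D" using crd(1) jD by linarith
      ultimately show ?thesis unfolding J_def by blast
    qed
    ultimately show "x \<in> \<Union>(C ` J)" by blast
  qed
  have ord: "card V \<le> D + 1" if V: "V \<subseteq> C ` J" "V \<noteq> {}" and x: "x \<in> \<Inter>V" for V x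
  proof -
    have "V \<subseteq> (\<lambda>j. C (?near x j, ?above x j)) ` {..D}"
    proof
      fix U assume U: "U \<in> V"
      then obtain S P where SP: "(S, P) \<in> J" "U = C (S, P)"
        using V(1) by (metis imageE prod.exhaust subsetD)
      then have "S = ?near x (card S) \<and> P = ?above x (card S)" using char x U by blast
      moreover have "card S \<le> D" using SP by (simp add: J_def)
      ultimately show "U \<in> (\<lambda>j. C (?near x j, ?above x j)) ` {..D}"
        using SP(2) by (intro image_eqI[of _ _ "card S"]) auto
    qed
    then show ?thesis using surj_card_le[of "{..D}" V] by simp
  qed
  show thesis
  proof
    show "open_cover X (C ` J)"
      unfolding open_cover_def using \<open>finite J\<close> opn cov by auto
    \<comment> \<open>\<open>cover_ord\<close> is a \<open>Max\<close>, so its set has to be finite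
      and nonempty; a point of \<open>X\<close> yields a singleton family.\<close>
    let ?M = "{card V - 1 | V. V \<subseteq> C ` J \<and> V \<noteq> {} \<and> finite V \<and> \<Inter>V \<noteq> {}}"
    obtain x where "x \<in> X" using assms(1) by blast
    then obtain U where "U \<in> C ` J" "x \<in> U" using cov by blast
    then have "card {U} - 1 \<in> ?M" by blast
    then have ne: "?M \<noteq> {}" by blast
    have bnd: "n \<le> D" if n: "n \<in> ?M" for n
    proof -
      obtain V x where "n = card V - 1" "V \<subseteq> C ` J" "V \<noteq> {}" "x \<in> \<Inter>V" using n by blast
      then show ?thesis using ord[of V x] by linarith
    qed
    then have "finite ?M" using finite_subset[of ?M "{..D}"] by blast
    then show "cover_ord (C ` J) \<le> D"
      unfolding cover_ord_def by (rule Max.boundedI[OF _ ne bnd])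
    show "g i y < 1" if U: "U \<in> C ` J" and xy: "x \<in> U" "y \<in> U" and i: "i \<in> I" "g i x = 0" for U x y i
    proof -
      obtain S P where SP: "(S, P) \<in> J" "U = C (S, P)"
        using U by (metis imageE prod.exhaust)
      then have h: "r (card S) < 1 / 2" using r_half by (simp add: J_def)
      have "i \<notin> S" "i \<notin> P" using xy(1) i h r_pos[of "card S"] unfolding SP(2) C_def by force+
      then have "g i y < 1 / 2 - r (card S)" using xy(2) i unfolding SP(2) C_def by blast
      then show ?thesis using r_pos[of "card S"] by simp
    qed
  qed
qed

section \<open>A union bound by counting\<close>

text \<open>For given \<open>y\<close> and \<open>D + 1\<close> indices, being bad at all of them
  leaves at most one value at each, hence at most \<open>q ^ (card I - (D + 1))\<close> choices. At
  most \<open>card Y * 2 ^ card I\<close> such pairs exist, so by \<open>count\<close> some choice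
  avoids them all.\<close>

lemma exists_choice_few_bad:
  fixes bad :: "'i \<Rightarrow> 'y \<Rightarrow> nat \<Rightarrow> bool"
  assumes "finite I" "finite Y"
    and uniq: "\<And>i y s t. i \<in> I \<Longrightarrow> y \<in> Y \<Longrightarrow> s < q \<Longrightarrow> t < q \<Longrightarrow> bad i y s \<Longrightarrow> bad i y t \<Longrightarrow> s = t"
    and count: "card Y * 2 ^ card I < q ^ (D + 1)"
  obtains s where "\<And>i. i \<in> I \<Longrightarrow> s i < q" "\<And>y. y \<in> Y \<Longrightarrow> card {i \<in> I. bad i y (s i)} \<le> D"
proof -
  have q: "q > 0" using count by (cases q) auto
  define B where "B = (\<lambda>(y, S). PiE I (\<lambda>i. if i \<in> S then {t. t < q \<and> bad i y t} else {..<q}))"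
  let ?Z = "Y \<times> {S. S \<subseteq> I \<and> card S = D + 1}"
  have "card (PiE I (\<lambda>_. {..<q}) \<inter> \<Union>(B ` ?Z)) < card (PiE I (\<lambda>_. {..<q}))"
  \<comment> \<open>The exponent \<open>card I - (D + 1)\<close> is a truncated subtraction; with
    fewer than \<open>D + 1\<close> indices there is no pair to avoid.\<close>
  proof (cases "card I < D + 1")
    case True
    then have "card S \<noteq> D + 1" if "S \<subseteq> I" for S
      using card_mono[OF assms(1) that] by linarith
    then have Z: "?Z = {}" by blast
    show ?thesis unfolding Z using q assms(1) by (simp add: card_PiE)
  next
    case False
    have finZ: "finite ?Z" using assms(1,2) by (auto intro!: finite_cartesian_product)
    have cB: "card (B (y, S)) \<le> q ^ (card I - (D + 1))" if "(y, S) \<in> ?Z" for y S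
    proof -
      have S: "S \<subseteq> I" "card S = D + 1" "y \<in> Y" using that by auto
      have one: "card {t. t < q \<and> bad i y t} \<le> 1" if "i \<in> S" for i
      proof (rule card_le_Suc0_iff_eq[THEN iffD2, simplified One_nat_def[symmetric]])
      qed (use uniq S that in auto)
      have "card (B (y, S)) = (\<Prod>i\<in>I. card (if i \<in> S then {t. t < q \<and> bad i y t} else {..<q}))"
        unfolding B_def using assms(1) by (simp add: card_PiE)
      also have "\<dots> \<le> (\<Prod>i\<in>I. if i \<in> S then 1 else q)"
        using one by (intro prod_mono) auto
      also have "\<dots> = q ^ card (I - S)"
        using assms(1) S(1) by (simp add: prod.If_cases Diff_eq)
      also have "card (I - S) = card I - (D + 1)"
        using S assms(1) by (simp add: card_Diff_subset finite_subset)
      finally show ?thesis .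
    qed
    have "card (PiE I (\<lambda>_. {..<q}) \<inter> \<Union>(B ` ?Z)) \<le> card (\<Union>(B ` ?Z))"
    proof (rule card_mono)
      have "finite (B z)" if "z \<in> ?Z" for z
        using that assms(1) by (auto simp: B_def intro!: finite_PiE)
      then show "finite (\<Union>(B ` ?Z))" using finZ by blast
    qed auto
    also have "\<dots> \<le> (\<Sum>z\<in>?Z. card (B z))" by (rule card_UN_le[OF finZ])
    also have "\<dots> \<le> card ?Z * q ^ (card I - (D + 1))"
      using sum_bounded_above[of ?Z "\<lambda>z. card (B z)" "q ^ (card I - (D + 1))"] cB by auto
    also have "\<dots> \<le> (card Y * 2 ^ card I) * q ^ (card I - (D + 1))"
    proof -
      have "card {S. S \<subseteq> I \<and> card S = D + 1} \<le> card (Pow I)"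
        using assms(1) by (intro card_mono) auto
      then show ?thesis using assms(1) by (simp add: card_cartesian_product card_Pow)
    qed
    also have "\<dots> < q ^ (D + 1) * q ^ (card I - (D + 1))"
      using count q by simp
    also have "\<dots> = q ^ card I" using False by (simp only: power_add[symmetric] not_less le_add_diff_inverse)
    also have "\<dots> = card (PiE I (\<lambda>_. {..<q}))" using assms(1) by (simp add: card_PiE)
    finally show ?thesis .
  qed
  then have "\<not> PiE I (\<lambda>_. {..<q}) \<subseteq> \<Union>(B ` ?Z)"
    using Int_absorb2[of "PiE I (\<lambda>_. {..<q})" "\<Union>(B ` ?Z)"] by (auto simp only: less_irrefl)
  then obtain s where s: "s \<in> PiE I (\<lambda>_. {..<q})" "s \<notin> \<Union>(B ` ?Z)" by blast
  show thesis
  proof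
    show "s i < q" if "i \<in> I" for i using s(1) that by auto
    show "card {i \<in> I. bad i y (s i)} \<le> D" if y: "y \<in> Y" for y
    proof (rule ccontr)
      assume "\<not> ?thesis"
      then obtain S where S: "S \<subseteq> {i \<in> I. bad i y (s i)}" "card S = D + 1"
        by (metis Suc_eq_plus1 not_less_eq_eq obtain_subset_with_card_n)
      then have "s \<in> B (y, S)" using s(1) unfolding B_def by auto
      then show False using s(2) S y by blast
    qed
  qed
qed

section \<open>Urysohn functions on the shells of an entourage\<close>

text \<open>Let \<open>P j\<close> be the points reached from \<open>A\<close> in \<open>j\<close>
  steps of \<open>E\<close>. The function \<open>F s\<close> passes from 0 on
  \<open>P (4 * s)\<close> to 1 off \<open>P (4 * s + 2)\<close>. A step of \<open>E\<close> out of
  its transition region ends in \<open>P (4 * s + 3)\<close>, where every later \<open>F t\<close>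
  vanishes.\<close>

lemma entourage_transition_functions:
  fixes X :: "'a::metric_space set"
  assumes "A \<subseteq> X" "refl_on X E" "sym E" "E \<subseteq> X \<times> X"
    and opn: "\<And>x. x \<in> X \<Longrightarrow> openin (top_of_set X) (E `` {x})"
  obtains F :: "nat \<Rightarrow> 'a \<Rightarrow> real" where "\<And>s. continuous_on X (F s)"
    "\<And>s x. x \<in> A \<Longrightarrow> F s x = 0"
    "\<And>s x. x \<in> X \<Longrightarrow> F s x < 1 \<Longrightarrow> x \<in> (E ^^ (4 * s + 2)) `` A"
    "\<And>s t x y. (x, y) \<in> E \<Longrightarrow> 0 < F s x \<Longrightarrow> F s x < 1 \<Longrightarrow> 0 < F t y \<Longrightarrow> F t y < 1 \<Longrightarrow> s = t"
proof -
  define P where "P j = (E ^^ j) `` A" for j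
  have step: "y \<in> P (Suc j)" if "x \<in> P j" "(x, y) \<in> E" for x y j
    using that unfolding P_def by (auto intro: relpow_Suc_I)
  have PX: "P j \<subseteq> X" for j
  proof (induction j)
    case (Suc j)
    then show ?case using assms(4) by (fastforce simp: P_def elim: relpow_Suc_E)
  qed (use assms(1) in \<open>simp add: P_def\<close>)
  have P_Suc: "P j \<subseteq> P (Suc j)" for j
    using step PX assms(2) by (meson refl_onD subset_iff)
  have P_mono: "P i \<subseteq> P j" if "i \<le> j" for i j
    using that P_Suc by (rule lift_Suc_mono_le[rotated])
  have P_open: "openin (top_of_set X) (P (Suc j))" for j
  proof -
    have "P (Suc j) = (\<Union>x\<in>P j. E `` {x})"
      unfolding P_def by (auto elim: relpow_Suc_E intro: relpow_Suc_I)
    then show ?thesis using opn PX by (metis (no_types, lifting) imageE openin_Union subsetD)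
  qed
  \<comment> \<open>The section of \<open>E\<close> at \<open>x\<close> is a neighbourhood of
    \<open>x\<close> and so meets \<open>P j\<close>; symmetry reverses the resulting step.\<close>
  have P_closure: "X \<inter> closure (P j) \<subseteq> P (Suc j)" for j
  proof
    fix x assume x: "x \<in> X \<inter> closure (P j)"
    then obtain G where G: "open G" "E `` {x} = X \<inter> G" using opn by (meson IntD1 openin_open)
    have "x \<in> G" using G(2) x assms(2) by (auto dest: refl_onD)
    then obtain y where "y \<in> P j" "y \<in> G"
      using x G(1) by (metis IntD2 IntE disjoint_iff open_Int_closure_eq_empty)
    then have "(x, y) \<in> E" using G(2) PX by blast
    then show "x \<in> P (Suc j)" using step \<open>y \<in> P j\<close> assms(3) by (meson symD)
  qed
  have "\<exists>f :: 'a \<Rightarrow> real. continuous_on X f \<and>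
      (\<forall>x\<in>P (4 * s). f x = 0) \<and> (\<forall>x\<in>X - P (4 * s + 2). f x = 1)" for s
  proof -
    have "normal_space (top_of_set X)"
      using metrizable_imp_normal_space metrizable_space_subtopology metrizable_space_euclidean
      by blast
    moreover have "closedin (top_of_set X) (X \<inter> closure (P (4 * s)))"
      by (simp add: closedin_closed_Int)
    moreover have "closedin (top_of_set X) (X - P (4 * s + 2))"
      using P_open[of "4 * s + 1"] by (intro closedin_diff) auto
    moreover have "disjnt (X \<inter> closure (P (4 * s))) (X - P (4 * s + 2))"
      using P_closure[of "4 * s"] P_Suc[of "4 * s + 1"] by (auto simp: disjnt_def)
    ultimately obtain f :: "'a \<Rightarrow> real" where f: "continuous_map (top_of_set X) euclideanreal f"
      "f ` (X \<inter> closure (P (4 * s))) \<subseteq> {0}" "f ` (X - P (4 * s + 2)) \<subseteq> {1}"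
      by (rule Urysohn_lemma_alt)
    have "P (4 * s) \<subseteq> X \<inter> closure (P (4 * s))" using PX closure_subset by blast
    then have "\<forall>x\<in>P (4 * s). f x = 0" using f(2) by blast
    then show ?thesis using f by (intro exI[of _ f]) auto
  qed
  then obtain F :: "nat \<Rightarrow> 'a \<Rightarrow> real" where F: "\<And>s. continuous_on X (F s)"
    "\<And>s x. x \<in> P (4 * s) \<Longrightarrow> F s x = 0" "\<And>s x. x \<in> X \<Longrightarrow> x \<notin> P (4 * s + 2) \<Longrightarrow> F s x = 1"
    by (metis DiffI)
  have no: False if "(x, y) \<in> E" "F s x < 1" "0 < F t y" "s < t" for x y s t
  proof -
    have "x \<in> P (4 * s + 2)" using that F(3)[of x s] assms(4) by force
    then have "y \<in> P (Suc (4 * s + 2))" using step that(1) by blast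
    then have "y \<in> P (4 * t)" using P_mono[of "Suc (4 * s + 2)" "4 * t"] that(4) by auto
    then show False using F(2) that(3) by force
  qed
  show thesis
  proof
    show "continuous_on X (F s)" for s by (rule F(1))
    show "F s x = 0" if "x \<in> A" for s x
      using F(2)[of x s] P_mono[of 0 "4 * s"] that by (auto simp: P_def)
    show "x \<in> (E ^^ (4 * s + 2)) `` A" if "x \<in> X" "F s x < 1" for s x
      using F(3)[of x s] that unfolding P_def by force
    show "s = t" if "(x, y) \<in> E" "0 < F s x" "F s x < 1" "0 < F t y" "F t y < 1" for s t x y
      using no[of x y s t] no[of y x t s] that assms(3) by (meson linorder_neqE_nat symD)
  qed
qed

section \<open>Entourages of an expansive action\<close>

lemma lattice_in_box:
  assumes "u \<in> lattice m"
  obtains N where "u \<in> box m N"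
proof
  have "\<bar>u i\<bar> \<le> (\<Sum>i<m. \<bar>u i\<bar>)" if "i < m" for i
    using that by (intro member_le_sum) auto
  then show "u \<in> box m (nat (\<Sum>i<m. \<bar>u i\<bar>))"
    using assms by (simp add: box_def sum_nonneg)
qed

text \<open>A relation rather than a metric, so that \<open>O\<close> and \<open>^^\<close> count
  steps; the strict inequality over a finite box makes sections relatively open for a continuous
  action.\<close>

definition bowen_rel ::
    "nat \<Rightarrow> 'a::metric_space set \<Rightarrow> ((nat \<Rightarrow> int) \<Rightarrow> 'a \<Rightarrow> 'a) \<Rightarrow> real \<Rightarrow> nat \<Rightarrow> ('a \<times> 'a) set" where
  "bowen_rel k X T c n = {(x, y). x \<in> X \<and> y \<in> X \<and> (\<forall>u\<in>box k n. dist (T u x) (T u y) < c)}"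

locale expansive_action =
  fixes k :: nat and X :: "'a::metric_space set" and T :: "(nat \<Rightarrow> int) \<Rightarrow> 'a \<Rightarrow> 'a" and c :: real
  assumes compact: "compact X" and action: "cont_action k X T" and c_pos: "0 < c"
    and separates: "x \<in> X \<Longrightarrow> y \<in> X \<Longrightarrow> x \<noteq> y \<Longrightarrow> \<exists>u\<in>lattice k. c < dist (T u x) (T u y)"
begin

abbreviation E :: "nat \<Rightarrow> ('a \<times> 'a) set" where
  "E \<equiv> bowen_rel k X T c"

lemma T_in: "u \<in> box k n \<Longrightarrow> x \<in> X \<Longrightarrow> T u x \<in> X"
  using action by (auto simp: cont_action_def box_def)

lemma T_cont: "u \<in> lattice k \<Longrightarrow> continuous_on X (T u)"
  using action by (auto simp: cont_action_def)

lemma E_mono: "m \<le> n \<Longrightarrow> E n \<subseteq> E m"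
  unfolding bowen_rel_def using box_mono[of m n k] by blast

lemma E_subset: "E n \<subseteq> X \<times> X"
  by (auto simp: bowen_rel_def)

lemma E_refl: "refl_on X (E n)"
  by (auto simp: bowen_rel_def c_pos intro: refl_onI)

lemma E_sym: "sym (E n)"
  by (auto simp: bowen_rel_def dist_commute intro: symI)

lemma E_open:
  assumes "x \<in> X"
  shows "openin (top_of_set X) (E n `` {x})"
proof -
  have "openin (top_of_set X) (X \<inter> T u -` ball (T u x) c)" if "u \<in> box k n" for u
    using T_cont[of u] that box_subset_lattice by (intro continuous_openin_preimage_gen) auto
  then have "openin (top_of_set X) ((\<Inter>u\<in>box k n. X \<inter> T u -` ball (T u x) c) \<inter> topspace (top_of_set X))"
    using finite_box by (intro openin_INT)
  moreover have "E n `` {x} = (\<Inter>u\<in>box k n. X \<inter> T u -` ball (T u x) c) \<inter> topspace (top_of_set X)"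
    using assms by (auto simp: bowen_rel_def)
  ultimately show ?thesis by simp
qed

lemma E_shift:
  assumes "(x, y) \<in> E (n + L)" "u \<in> box k n"
  shows "(T u x, T u y) \<in> E L"
proof -
  have xy: "x \<in> X" "y \<in> X" using assms(1) by (auto simp: bowen_rel_def)
  have "dist (T v (T u x)) (T v (T u y)) < c" if "v \<in> box k L" for v
  proof -
    have "T (\<lambda>i. v i + u i) z = T v (T u z)" if "z \<in> X" for z
      using action \<open>v \<in> box k L\<close> assms(2) that box_subset_lattice unfolding cont_action_def by blast
    moreover have "(\<lambda>i. v i + u i) \<in> box k (n + L)"
      using box_add[OF that assms(2)] by (simp add: add.commute)
    ultimately show ?thesis using assms(1) xy by (auto simp: bowen_rel_def)
  qed
  then show ?thesis using xy T_in[OF assms(2)] by (simp add: bowen_rel_def)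
qed

text \<open>Otherwise pairs in \<open>E L\<close> at distance at least \<open>d\<close> accumulate
  at a pair of distinct points. In the limit their orbits stay within \<open>c\<close> non-strictly,
  which still contradicts the strict inequality in \<open>separates\<close>.\<close>

lemma E_shrinks:
  assumes "0 < d"
  obtains L where "\<And>x y. (x, y) \<in> E L \<Longrightarrow> dist x y < d"
proof -
  have "\<exists>L. \<forall>x y. (x, y) \<in> E L \<longrightarrow> dist x y < d"
  proof (rule ccontr)
    assume "\<not> ?thesis"
    then have "\<forall>L. \<exists>z. z \<in> E L \<and> d \<le> dist (fst z) (snd z)"
      by (metis fst_conv not_le snd_conv)
    then obtain z where z: "\<And>L. z L \<in> E L" "\<And>L. d \<le> dist (fst (z L)) (snd (z L))" by metis
    have zX: "z L \<in> X \<times> X" for L using z(1) E_subset by blast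
    have "seq_compact (X \<times> X)"
      using compact_Times[OF compact compact] compact_eq_seq_compact_metric by blast
    then obtain l r where l: "l \<in> X \<times> X" "strict_mono r" "(z \<circ> r) \<longlonglongrightarrow> l"
      using zX unfolding seq_compact_def by metis
    have lim: "(\<lambda>n. fst (z (r n))) \<longlonglongrightarrow> fst l" "(\<lambda>n. snd (z (r n))) \<longlonglongrightarrow> snd l"
      using tendsto_fst[OF l(3)] tendsto_snd[OF l(3)] by (simp_all add: o_def)
    have "d \<le> dist (fst l) (snd l)"
      by (rule Lim_bounded2[OF tendsto_dist[OF lim], of 0]) (use z(2) in auto)
    then have "fst l \<noteq> snd l" using assms by auto
    then obtain u where u: "u \<in> lattice k" "c < dist (T u (fst l)) (T u (snd l))"
      using separates[of "fst l" "snd l"] l(1) by auto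
    obtain N where N: "u \<in> box k N" using lattice_in_box[OF u(1)] .
    have lim2: "(\<lambda>n. T u (fst (z (r n)))) \<longlonglongrightarrow> T u (fst l)"
      "(\<lambda>n. T u (snd (z (r n)))) \<longlonglongrightarrow> T u (snd l)"
      using l(1) zX by (auto intro!: continuous_on_tendsto_compose[OF T_cont[OF u(1)]] lim
          always_eventually simp: mem_Times_iff)
    have "dist (T u (fst (z (r n)))) (T u (snd (z (r n)))) \<le> c" if "n \<ge> N" for n
    proof -
      have "n \<le> r n" using l(2) by (rule seq_suble)
      then have "u \<in> box k (r n)" using N box_mono[of N "r n" k] that by auto
      then show ?thesis using z(1)[of "r n"] by (auto simp: bowen_rel_def)
    qed
    then have "dist (T u (fst l)) (T u (snd l)) \<le> c"
      by (intro Lim_bounded[OF tendsto_dist[OF lim2], of N]) auto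
    then show False using u(2) by simp
  qed
  then show thesis using that by blast
qed

text \<open>Some \<open>E L\<close> forces distance below \<open>c / 2\<close>, and
  \<open>T u\<close> with \<open>u\<close> in \<open>box k n\<close> maps \<open>E (n + L)\<close>
  into \<open>E L\<close>; the triangle inequality does the rest. This is the source of the
  exponential gain: each further \<open>L\<close> in the radius doubles the number of steps
  allowed.\<close>

lemma E_halving:
  obtains L where "\<And>n. E (n + L) O E (n + L) \<subseteq> E n"
proof -
  obtain L where L: "\<And>x y. (x, y) \<in> E L \<Longrightarrow> dist x y < c / 2"
    using E_shrinks[of "c / 2"] c_pos by auto
  show thesis
  proof (rule that, rule subrelI, elim relcompEpair)
    fix n x y z assume *: "(x, y) \<in> E (n + L)" "(y, z) \<in> E (n + L)"
    have "dist (T u x) (T u z) < c" if "u \<in> box k n" for u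
      using L[OF E_shift[OF *(1) that]] L[OF E_shift[OF *(2) that]]
        dist_triangle[of "T u x" "T u z" "T u y"] by linarith
    then show "(x, z) \<in> E n" using * by (simp add: bowen_rel_def)
  qed
qed

text \<open>The chain is cut into two of at most \<open>2 ^ n\<close> steps; by induction each lies
  in \<open>E (a + L)\<close>, and \<open>L\<close> merges them. The premise
  \<open>x \<in> X\<close> serves the empty chain.\<close>

lemma E_iterate:
  assumes L: "\<And>n. E (n + L) O E (n + L) \<subseteq> E n"
  shows "x \<in> X \<Longrightarrow> (x, y) \<in> E (a + L * n) ^^ j \<Longrightarrow> j \<le> 2 ^ n \<Longrightarrow> (x, y) \<in> E a"
proof (induction n arbitrary: a j x y)
  case 0
  then have "j = 0 \<or> j = 1" by auto
  then show ?case using 0 refl_onD[OF E_refl] by auto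
next
  case (Suc n)
  define i where "i = min j (2 ^ n)"
  have ij: "i \<le> 2 ^ n" "j - i \<le> 2 ^ n" "j = i + (j - i)"
    using Suc.prems(3) by (auto simp: i_def)
  have "(x, y) \<in> E (a + L + L * n) ^^ i O E (a + L + L * n) ^^ (j - i)"
    using Suc.prems(2) ij(3) by (metis add.assoc mult_Suc_right relpow_add)
  then obtain w where w: "(x, w) \<in> E (a + L + L * n) ^^ i" "(w, y) \<in> E (a + L + L * n) ^^ (j - i)"
    by auto
  have "(x, w) \<in> E (a + L)" using Suc.IH[OF Suc.prems(1) w(1) ij(1)] .
  moreover from this have "w \<in> X" using E_subset by blast
  then have "(w, y) \<in> E (a + L)" using Suc.IH[OF _ w(2) ij(2)] by blast
  ultimately show ?case using L by blast
qed

text \<open>For a unit move \<open>w\<close>, commutation turns \<open>T v (R w x)\<close> into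
  \<open>R w (T v x)\<close>, so closeness of \<open>T v x\<close> and \<open>T v y\<close> passes
  through the modulus of continuity of \<open>R w\<close>. Each unit move costs the same
  \<open>M\<close>, hence a loss linear in \<open>N\<close>.\<close>

lemma commuting_action_E:
  assumes R: "cont_action m X R"
    and comm: "\<And>u w x. u \<in> lattice k \<Longrightarrow> w \<in> lattice m \<Longrightarrow> x \<in> X \<Longrightarrow> T u (R w x) = R w (T u x)"
  obtains M where "\<And>N n x y u. (x, y) \<in> E (n + M * N) \<Longrightarrow> u \<in> box m N \<Longrightarrow> (R u x, R u y) \<in> E n"
proof -
  obtain d where d: "0 < d"
    "\<And>x y w. x \<in> X \<Longrightarrow> y \<in> X \<Longrightarrow> dist x y < d \<Longrightarrow> w \<in> box m 1 \<Longrightarrow> dist (R w x) (R w y) < c"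
    using compact_cont_action_equicontinuous[OF compact R c_pos] by metis
  obtain M where M: "\<And>x y. (x, y) \<in> E M \<Longrightarrow> dist x y < d" using E_shrinks[OF d(1)] by metis
  have R_in: "R w x \<in> X" if "w \<in> box m N" "x \<in> X" for w x N
    using R that by (auto simp: cont_action_def box_def)
  have one: "(R w x, R w y) \<in> E n" if "(x, y) \<in> E (n + M)" "w \<in> box m 1" for x y w n
  proof -
    have xy: "x \<in> X" "y \<in> X" using that(1) by (auto simp: bowen_rel_def)
    have "dist (T v (R w x)) (T v (R w y)) < c" if v: "v \<in> box k n" for v
    proof -
      have "T v (R w z) = R w (T v z)" if "z \<in> X" for z
        using comm v \<open>w \<in> box m 1\<close> that box_subset_lattice by blast
      then show ?thesis
        using d(2)[OF T_in[OF v] T_in[OF v] M[OF E_shift[OF \<open>(x, y) \<in> E (n + M)\<close> v]] \<open>w \<in> box m 1\<close>] xy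
        by simp
    qed
    then show ?thesis using xy R_in[OF that(2)] by (simp add: bowen_rel_def)
  qed
  have "(R u x, R u y) \<in> E n" if "(x, y) \<in> E (n + M * N)" "u \<in> box m N" for N n x y u
    using that
  proof (induction N arbitrary: n u)
    case 0
    have "u = (\<lambda>i. 0)"
    proof
      show "u i = 0" for i using 0(2) by (cases "i < m") (auto simp: box_def lattice_def)
    qed
    moreover have "x \<in> X" "y \<in> X" using 0(1) by (auto simp: bowen_rel_def)
    ultimately show ?case using R 0(1) by (simp add: cont_action_def)
  next
    case (Suc N)
    obtain v w where vw: "v \<in> box m 1" "w \<in> box m N" "u = (\<lambda>i. v i + w i)"
      using box_split_Suc[OF Suc.prems(2)] .
    have "(x, y) \<in> E ((n + M) + M * N)" using Suc.prems(1) by (simp add: algebra_simps)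
    then have "(R w x, R w y) \<in> E (n + M)" using Suc.IH vw(2) by blast
    then have "(R v (R w x), R v (R w y)) \<in> E n" using one vw(1) by blast
    moreover have "R u z = R v (R w z)" if "z \<in> X" for z
      using R vw that box_subset_lattice unfolding cont_action_def by blast
    moreover have "x \<in> X" "y \<in> X" using Suc.prems(1) by (auto simp: bowen_rel_def)
    ultimately show ?case by simp
  qed
  then show thesis using that by blast
qed

section \<open>Bounding \<open>widim\<close> along \<open>R\<close> by covering numbers of
  \<open>T\<close>\<close>

text \<open>\<open>A\<close> and \<open>b\<close> are fixed before \<open>N\<close>,
  \<open>D\<close> and \<open>e\<close>, which leaves the asymptotics for later. The premise is the
  counting inequality with \<open>q = 2 ^ N\<close> and at most \<open>b * (2 * N + 1) ^ m\<close>
  coordinates.\<close>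

lemma widim_le_of_covnum:
  assumes ne: "X \<noteq> {}" and R: "cont_action m X R"
    and comm: "\<And>u w x. u \<in> lattice k \<Longrightarrow> w \<in> lattice m \<Longrightarrow> x \<in> X \<Longrightarrow> T u (R w x) = R w (T u x)"
    and eps: "0 < \<epsilon>"
  obtains A b :: nat where "A > 0"
    "\<And>N D e. 0 < e \<Longrightarrow> e \<le> c \<Longrightarrow>
       covnum X (dbox T k (A * (N + 1))) e * 2 ^ (b * (2 * N + 1) ^ m) < 2 ^ (N * (D + 1)) \<Longrightarrow>
       widim X (dbox R m N) \<epsilon> \<le> D"
proof -
  \<comment> \<open>One third for each hop: from \<open>R u x\<close> to \<open>p\<close>, on to
    \<open>z\<close>, and on to \<open>R u y\<close>.\<close>
  define d where "d = \<epsilon> / 3"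
  have "0 < d" using eps by (simp add: d_def)
  obtain P where P: "finite P" "X \<subseteq> (\<Union>p\<in>P. ball p d)"
    using compact \<open>0 < d\<close> unfolding compact_eq_totally_bounded by metis
  obtain n0 where n0: "\<And>x y. (x, y) \<in> E n0 \<Longrightarrow> dist x y < d" using E_shrinks[OF \<open>0 < d\<close>] by metis
  obtain L where L: "\<And>n. E (n + L) O E (n + L) \<subseteq> E n" using E_halving by blast
  obtain M where M: "\<And>N n x y u. (x, y) \<in> E (n + M * N) \<Longrightarrow> u \<in> box m N \<Longrightarrow> (R u x, R u y) \<in> E n"
    using commuting_action_E[OF R comm] by metis
  define A where "A = n0 + 2 * L + M + 1"
  have R_in: "R w x \<in> X" if "w \<in> box m N" "x \<in> X" for w x N
    using R that by (auto simp: cont_action_def box_def)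
  show thesis
  proof (rule that)
    show "A > 0" by (simp add: A_def)
    fix N D :: nat and e :: real
    assume e: "0 < e" "e \<le> c"
      and count: "covnum X (dbox T k (A * (N + 1))) e * 2 ^ (card P * (2 * N + 1) ^ m) < 2 ^ (N * (D + 1))"
    \<comment> \<open>For \<open>s < 2 ^ N\<close> at most
      \<open>4 * s + 2 \<le> 2 ^ (N + 2)\<close> steps are taken, so \<open>N + 2\<close> halvings
      keep them inside \<open>E n0\<close>.\<close>
    define E' where "E' = E (n0 + L * (N + 2))"
    have E': "refl_on X E'" "sym E'" "E' \<subseteq> X \<times> X"
      "\<And>x. x \<in> X \<Longrightarrow> openin (top_of_set X) (E' `` {x})"
      unfolding E'_def by (rule E_refl E_sym E_subset E_open, assumption?)+
    define transition where "transition p F \<longleftrightarrow> (\<forall>s. continuous_on X (F s)) \<and>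
        (\<forall>s. \<forall>x\<in>X \<inter> ball p d. F s x = 0) \<and>
        (\<forall>s. \<forall>x\<in>X. F s x < 1 \<longrightarrow> x \<in> (E' ^^ (4 * s + 2)) `` (X \<inter> ball p d)) \<and>
        (\<forall>s t x y. (x, y) \<in> E' \<longrightarrow> 0 < F s x \<longrightarrow> F s x < 1 \<longrightarrow> 0 < F t y \<longrightarrow> F t y < 1 \<longrightarrow> s = t)"
      for p and F :: "nat \<Rightarrow> 'a \<Rightarrow> real"
    have "\<exists>F. transition p F" for p
    proof (rule entourage_transition_functions[of "X \<inter> ball p d" X E'])
      fix F :: "nat \<Rightarrow> 'a \<Rightarrow> real"
      assume "\<And>s. continuous_on X (F s)"
        "\<And>s x. x \<in> X \<inter> ball p d \<Longrightarrow> F s x = 0"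
        "\<And>s x. x \<in> X \<Longrightarrow> F s x < 1 \<Longrightarrow> x \<in> (E' ^^ (4 * s + 2)) `` (X \<inter> ball p d)"
        "\<And>s t x y. (x, y) \<in> E' \<Longrightarrow> 0 < F s x \<Longrightarrow> F s x < 1 \<Longrightarrow> 0 < F t y \<Longrightarrow> F t y < 1 \<Longrightarrow> s = t"
      then show "\<exists>F. transition p F"
        unfolding transition_def by (intro exI[of _ F] conjI allI ballI impI)
    qed (use E' in auto)
    then obtain F where F: "\<And>p. transition p (F p)" by metis
    note F' = F[unfolded transition_def]
    have F_cont: "continuous_on X (F p s)" for p s
      by (rule spec[OF conjunct1[OF F']])
    have F0: "F p s x = 0" if "x \<in> X \<inter> ball p d" for p s x
      by (rule bspec[OF spec[OF conjunct1[OF conjunct2[OF F']]] that])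
    have F1: "x \<in> (E' ^^ (4 * s + 2)) `` (X \<inter> ball p d)" if "x \<in> X" "F p s x < 1" for p s x
      by (rule mp[OF bspec[OF spec[OF conjunct1[OF conjunct2[OF conjunct2[OF F']]]] that(1)] that(2)])
    have F_uniq: "s = t"
      if "(x, y) \<in> E'" "0 < F p s x" "F p s x < 1" "0 < F p t y" "F p t y < 1" for p s t x y
      using conjunct2[OF conjunct2[OF conjunct2[OF F']]] that by iprover
    define I where "I = box m N \<times> P"
    have finI: "finite I" using P(1) finite_box by (simp add: I_def)
    have cardI: "card I \<le> card P * (2 * N + 1) ^ m"
      using card_box_le[of m N] by (simp add: I_def card_cartesian_product mult.commute)
    obtain \<W> where W: "open_cover X \<W>" "\<And>W. W \<in> \<W> \<Longrightarrow> rdiam (dbox T k (A * (N + 1))) W < e"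
      "card \<W> = covnum X (dbox T k (A * (N + 1))) e"
      using covnum_attained[OF compact action e(1), of "A * (N + 1)"] by metis
    have W_sub: "W \<subseteq> X" if "W \<in> \<W>" for W
      using W(1) that by (auto simp: open_cover_def dest: openin_imp_subset)
    have W_E: "(R u x, R u y) \<in> E'" if "W \<in> \<W>" "x \<in> W" "y \<in> W" "u \<in> box m N" for W x y u
    proof -
      have "dist (T v x) (T v y) < c" if "v \<in> box k (A * (N + 1))" for v
        using dbox_eq_diam_bounds_dist[OF compact action W_sub W(2) _ _ that] \<open>W \<in> \<W>\<close>
          \<open>x \<in> W\<close> \<open>y \<in> W\<close> e(2) by force
      then have "(x, y) \<in> E (A * (N + 1))"
        using that W_sub unfolding bowen_rel_def by blast
      moreover have "n0 + L * (N + 2) + M * N \<le> A * (N + 1)"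
        by (simp add: A_def algebra_simps)
      ultimately have "(x, y) \<in> E (n0 + L * (N + 2) + M * N)" using E_mono by blast
      then show ?thesis using M that(4) unfolding E'_def by blast
    qed
    \<comment> \<open>By \<open>W_E\<close> any two points of the image of \<open>W\<close> under
      \<open>R u\<close> are related by \<open>E'\<close>, so this image meets the transition region
      of at most one \<open>s\<close>.\<close>
    define bad where "bad = (\<lambda>(u, p) W s. \<exists>x\<in>W. 0 < F p s (R u x) \<and> F p s (R u x) < 1)"
    obtain s where s: "\<And>i. i \<in> I \<Longrightarrow> s i < 2 ^ N"
      "\<And>W. W \<in> \<W> \<Longrightarrow> card {i \<in> I. bad i W (s i)} \<le> D"
    proof (rule exists_choice_few_bad[of I \<W> "2 ^ N" bad D])
      show "finite \<W>" using W(1) by (simp add: open_cover_def)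
      show "s = t" if "i \<in> I" and W': "W \<in> \<W>" and *: "bad i W s" "bad i W t" for i W s t
      proof -
        obtain u p where i: "i = (u, p)" "u \<in> box m N" using \<open>i \<in> I\<close> by (auto simp: I_def)
        obtain x y where "x \<in> W" "0 < F p s (R u x)" "F p s (R u x) < 1"
          and "y \<in> W" "0 < F p t (R u y)" "F p t (R u y) < 1"
          using * unfolding i bad_def by auto
        then show ?thesis using F_uniq[OF W_E[OF W' _ _ i(2)]] by blast
      qed
      have "card \<W> * 2 ^ card I \<le> card \<W> * 2 ^ (card P * (2 * N + 1) ^ m)"
        using cardI by (intro mult_left_mono power_increasing) auto
      also have "\<dots> < 2 ^ (N * (D + 1))" using count W(3) by simp
      finally show "card \<W> * 2 ^ card I < (2 ^ N) ^ (D + 1)" by (simp only: power_mult)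
    qed (use finI in auto)
    define g where "g = (\<lambda>(u, p) x. F p (s (u, p)) (R u x))"
    have g_cont: "continuous_on X (g i)" if "i \<in> I" for i
    proof -
      obtain u p where i: "i = (u, p)" "u \<in> box m N" using \<open>i \<in> I\<close> by (auto simp: I_def)
      have "continuous_on X (R u)" using R i(2) by (auto simp: cont_action_def box_def)
      then have "continuous_on X (\<lambda>x. F p (s (u, p)) (R u x))"
        by (rule continuous_on_compose2[OF F_cont]) (use R_in[OF i(2)] in auto)
      then show ?thesis by (simp add: g_def i(1))
    qed
    have g_few: "card {i \<in> I. 0 < g i x \<and> g i x < 1} \<le> D" if x: "x \<in> X" for x
    proof -
      obtain W where "W \<in> \<W>" "x \<in> W" using W(1) x by (auto simp: open_cover_def)
      then have "{i \<in> I. 0 < g i x \<and> g i x < 1} \<subseteq> {i \<in> I. bad i W (s i)}"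
        by (auto simp: g_def bad_def)
      then have "card {i \<in> I. 0 < g i x \<and> g i x < 1} \<le> card {i \<in> I. bad i W (s i)}"
        using finI by (intro card_mono) auto
      then show ?thesis using s(2)[OF \<open>W \<in> \<W>\<close>] by linarith
    qed
    obtain \<U> where U: "open_cover X \<U>" "cover_ord \<U> \<le> D"
      "\<And>U x y i. U \<in> \<U> \<Longrightarrow> x \<in> U \<Longrightarrow> y \<in> U \<Longrightarrow> i \<in> I \<Longrightarrow> g i x = 0 \<Longrightarrow> g i y < 1"
      using transition_cover[OF ne finI g_cont g_few] by blast
    show "widim X (dbox R m N) \<epsilon> \<le> D"
    proof (rule widim_le[OF U(1) _ U(2)], intro rdiam_le dbox_le)
      fix U x y u assume *: "U \<in> \<U>" "x \<in> U" "y \<in> U" "u \<in> box m N"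
      have "U \<subseteq> X" using U(1) *(1) by (auto simp: open_cover_def dest: openin_imp_subset)
      then have X: "R u x \<in> X" "R u y \<in> X" using * R_in by auto
      then obtain p where p: "p \<in> P" "R u x \<in> X \<inter> ball p d" using P(2) by auto
      have i: "(u, p) \<in> I" using *(4) p(1) by (simp add: I_def)
      \<comment> \<open>The coordinate of a net point near \<open>R u x\<close> vanishes at
        \<open>x\<close>, hence stays below 1 at \<open>y\<close>; so \<open>R u y\<close> is few
        steps of \<open>E'\<close> away from the ball around \<open>p\<close>.\<close>
      have "g (u, p) x = 0" using F0[OF p(2)] by (simp add: g_def)
      then have "g (u, p) y < 1" by (rule U(3)[OF *(1-3) i])
      then have "F p (s (u, p)) (R u y) < 1" by (simp add: g_def)
      then obtain z where z: "z \<in> X \<inter> ball p d" "(z, R u y) \<in> E' ^^ (4 * s (u, p) + 2)"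
        using F1[OF X(2)] by blast
      have "4 * s (u, p) + 2 \<le> 2 ^ (N + 2)" using s(1)[OF i] by simp
      then have "(z, R u y) \<in> E n0"
        using E_iterate[OF L _ z(2)[unfolded E'_def]] z(1) by blast
      then have "dist z (R u y) < d" by (rule n0)
      moreover have "dist p z < d" "dist p (R u x) < d" using z(1) p(2) by auto
      moreover have "dist (R u x) (R u y) \<le> dist p (R u x) + dist p z + dist z (R u y)"
        using dist_triangle[of "R u x" "R u y" p] dist_triangle[of p "R u y" z]
        by (simp add: dist_commute)
      ultimately show "dist (R u x) (R u y) \<le> \<epsilon>" by (simp add: d_def)
    qed (use eps in auto)
  qed
qed

section \<open>Passage to the limit\<close>

text \<open>Dividing the counting inequality by \<open>N\<close> turns the entropy term into a small
  multiple of \<open>n ^ k / N\<close>, of order \<open>n ^ m\<close> as \<open>k = Suc m\<close>,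
  and the coordinate term into order \<open>n ^ m / N\<close>. Both are small relative to
  \<open>n ^ m\<close>.\<close>

lemma mdim_seq_tendsto_0:
  assumes k: "k = Suc m" and ne: "X \<noteq> {}" and R: "cont_action m X R"
    and comm: "\<And>u w x. u \<in> lattice k \<Longrightarrow> w \<in> lattice m \<Longrightarrow> x \<in> X \<Longrightarrow> T u (R w x) = R w (T u x)"
    and ent: "zero_entropy k X T" and eps: "0 < \<epsilon>"
  shows "mdim_seq m X R \<epsilon> \<longlonglongrightarrow> 0"
proof (rule tendstoI)
  fix r :: real assume r: "0 < r"
  obtain A b :: nat where A: "A > 0" and wid: "\<And>N D e. 0 < e \<Longrightarrow> e \<le> c \<Longrightarrow>
       covnum X (dbox T k (A * (N + 1))) e * 2 ^ (b * (2 * N + 1) ^ m) < 2 ^ (N * (D + 1)) \<Longrightarrow>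
       widim X (dbox R m N) \<epsilon> \<le> D"
    using widim_le_of_covnum[OF ne R comm eps] by blast
  define B where "B = real (2 * A + 1) ^ k"
  have B: "0 < B" by (simp add: B_def)
  \<comment> \<open>With \<open>n \<le> 3 * real N\<close> the entropy term is at most
    \<open>3 * r / 8\<close>; the coordinate term stays below \<open>r / 2\<close>.\<close>
  define \<eta> where "\<eta> = r * ln 2 / (8 * B)"
  have \<eta>: "0 < \<eta>" using r B by (simp add: \<eta>_def)
  \<comment> \<open>Zero entropy is applied at a single scale \<open>e\<close> below
    \<open>c\<close>.\<close>
  have "\<forall>\<^sub>F e in at_right 0. lim (entropy_seq k X T e) < \<eta>"
    using ent \<eta> unfolding zero_entropy_def by (auto dest: order_tendstoD(2))
  moreover have "\<forall>\<^sub>F e in at_right 0. e \<in> {0<..<c}"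
    by (rule eventually_at_right_real[OF c_pos])
  ultimately have "\<forall>\<^sub>F e in at_right 0. lim (entropy_seq k X T e) < \<eta> \<and> e \<in> {0<..<c}"
    by (rule eventually_conj)
  then obtain e where e: "lim (entropy_seq k X T e) < \<eta>" "0 < e" "e \<le> c"
    using eventually_happens[of _ "at_right (0::real)"] by fastforce
  have "entropy_seq k X T e \<longlonglongrightarrow> lim (entropy_seq k X T e)"
    using ent e(2) unfolding zero_entropy_def by (simp add: convergent_LIMSEQ_iff)
  then have "\<forall>\<^sub>F n in sequentially. entropy_seq k X T e n < \<eta>"
    using e(1) by (rule order_tendstoD)
  \<comment> \<open>Positivity of \<open>A\<close> makes the radii \<open>A * (N + 1)\<close> a
    subsequence.\<close>
  moreover have "filterlim (\<lambda>N. A * (N + 1)) at_top sequentially"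
    using A by (intro filterlim_subseq) (simp add: strict_mono_def)
  ultimately have "\<forall>\<^sub>F N in sequentially. entropy_seq k X T e (A * (N + 1)) < \<eta>"
    by (rule eventually_compose_filterlim)
  moreover have "\<forall>\<^sub>F N in sequentially. real b / real N < r / 2"
    using r by (intro order_tendstoD(2)[OF lim_const_over_n]) auto
  moreover have "\<forall>\<^sub>F N in sequentially. N > 0" by (rule eventually_gt_at_top)
  ultimately show "\<forall>\<^sub>F N in sequentially. dist (mdim_seq m X R \<epsilon> N) 0 < r"
  proof eventually_elim
    case (elim N)
    define K where "K = covnum X (dbox T k (A * (N + 1))) e"
    define n where "n = real (2 * N + 1)"
    \<comment> \<open>\<open>Q\<close> is the value of \<open>D + 1\<close> that gives equality in
      the logarithm of the counting inequality, with \<open>ln K\<close> replaced by its upper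
      bound; the floor \<open>D\<close> satisfies \<open>Q < D + 1\<close>.\<close>
    define Q where "Q = (\<eta> * B * n ^ k + real b * n ^ m * ln 2) / (real N * ln 2)"
    define D where "D = nat \<lfloor>Q\<rfloor>"
    have n: "0 < n" "n \<le> 3 * real N" using elim(3) by (auto simp: n_def)
    have Q: "0 \<le> Q" using \<eta> B n(1) by (simp add: Q_def)
    have D: "real D \<le> Q" "Q < real D + 1" using Q by (auto simp: D_def)
    have pos: "0 < real ((2 * (A * (N + 1)) + 1) ^ k)"
      by (simp only: of_nat_0_less_iff zero_less_power)
    have "ln (real K) < \<eta> * real ((2 * (A * (N + 1)) + 1) ^ k)"
      using elim(1) unfolding entropy_seq_def K_def by (simp only: pos_divide_less_eq[OF pos])
    also have "\<dots> \<le> \<eta> * (B * n ^ k)"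
    proof -
      have "2 * (A * (N + 1)) + 1 \<le> (2 * A + 1) * (2 * N + 1)" by (simp add: algebra_simps)
      then have "(2 * (A * (N + 1)) + 1) ^ k \<le> ((2 * A + 1) * (2 * N + 1)) ^ k" by (rule power_mono) simp
      then have "real ((2 * (A * (N + 1)) + 1) ^ k) \<le> real (((2 * A + 1) * (2 * N + 1)) ^ k)"
        by (rule of_nat_mono)
      also have "\<dots> = B * n ^ k"
        by (simp only: B_def n_def of_nat_power of_nat_mult power_mult_distrib)
      finally show ?thesis using \<eta> by (intro mult_left_mono) auto
    qed
    finally have lnK: "ln (real K) < \<eta> * B * n ^ k" by simp
    have "widim X (dbox R m N) \<epsilon> \<le> D"
    proof (rule wid[OF e(2,3)], fold K_def)
      show "K * 2 ^ (b * (2 * N + 1) ^ m) < 2 ^ (N * (D + 1))"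
      proof (cases "K = 0")
        case False
        have "ln (real K * 2 ^ (b * (2 * N + 1) ^ m)) = ln (real K) + real b * n ^ m * ln 2"
          using False by (simp add: ln_mult ln_realpow n_def)
        also have "\<dots> < Q * (real N * ln 2)" using lnK elim(3) by (simp add: Q_def)
        also have "\<dots> < (real D + 1) * (real N * ln 2)" using D(2) elim(3) by simp
        also have "\<dots> = ln (2 ^ (N * (D + 1)))" by (simp add: ln_realpow algebra_simps)
        finally have "real K * 2 ^ (b * (2 * N + 1) ^ m) < 2 ^ (N * (D + 1))"
          using False by (subst (asm) ln_less_cancel_iff) auto
        then have "real (K * 2 ^ (b * (2 * N + 1) ^ m)) < real (2 ^ (N * (D + 1)))" by simp
        then show ?thesis by (simp only: of_nat_less_iff)
      qed simp
    qed
    then have "mdim_seq m X R \<epsilon> N \<le> Q / n ^ m"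
      using D(1) n(1) unfolding mdim_seq_def n_def by (simp add: divide_right_mono)
    also have "\<dots> = \<eta> * B * n / (real N * ln 2) + real b / real N"
      using n(1) elim(3) by (simp add: Q_def k field_simps)
    also have "\<dots> = r / 8 * (n / real N) + real b / real N"
      using B by (simp add: \<eta>_def)
    also have "\<dots> < r"
    proof -
      have "n / real N \<le> 3" using n elim(3) by (simp add: field_simps)
      then have "r / 8 * (n / real N) \<le> r / 8 * 3" using r by (intro mult_left_mono) auto
      then show ?thesis using elim(2) r by linarith
    qed
    finally show ?case by (simp add: mdim_seq_def)
  qed
qed

end

theorem theorem1p8:
  fixes X :: "'a::metric_space set"
    and T R :: "(nat \<Rightarrow> int) \<Rightarrow> 'a \<Rightarrow> 'a"
    and k :: nat
  assumes "k \<ge> 1"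
    and "compact X" and "X \<noteq> {}"
    and "cont_action k X T" and "expansive k X T"
    and "cont_action (k - 1) X R"
    and "\<forall>u\<in>lattice k. \<forall>w\<in>lattice (k - 1). \<forall>x\<in>X. T u (R w x) = R w (T u x)"
    and "zero_entropy k X T"
  shows "zero_mdim (k - 1) X R"
proof -
  obtain c where c: "0 < c"
    "\<And>x y. x \<in> X \<Longrightarrow> y \<in> X \<Longrightarrow> x \<noteq> y \<Longrightarrow> c < (SUP u\<in>lattice k. dist (T u x) (T u y))"
    using assms(5) unfolding expansive_def by blast
  have ne: "lattice k \<noteq> {}" by (auto simp: lattice_def)
  interpret expansive_action k X T c
  proof
    \<comment> \<open>A supremum above \<open>c\<close> over a nonempty set has a term above
      \<open>c\<close>.\<close>
    show "\<exists>u\<in>lattice k. c < dist (T u x) (T u y)" if "x \<in> X" "y \<in> X" "x \<noteq> y" for x y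
      using less_cSupE[OF c(2)[OF that]] ne by (metis (no_types, lifting) image_iff image_is_empty)
  qed (use assms c in auto)
  have "mdim_seq (k - 1) X R \<epsilon> \<longlonglongrightarrow> 0" if "0 < \<epsilon>" for \<epsilon>
    using assms that by (intro mdim_seq_tendsto_0) auto
  \<comment> \<open>Each inner limit is exactly 0, so the outer limit is that of a function
    vanishing at all positive scales.\<close>
  then have "convergent (mdim_seq (k - 1) X R \<epsilon>)" "lim (mdim_seq (k - 1) X R \<epsilon>) = 0" if "0 < \<epsilon>" for \<epsilon>
    using that by (auto simp: convergent_def intro: limI)
  moreover have "\<forall>\<^sub>F \<epsilon> in at_right (0::real). 0 < \<epsilon>"
    by (rule eventually_at_right_less)
  ultimately show ?thesis
    unfolding zero_mdim_def
    by (auto intro!: tendsto_eventually elim!: eventually_mono)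
qed

end
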